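(* $\displaystyle\sum_{n\ge0}|\mathrm{VHC}(\operatorname{Av}_n(231,321))|x^n=\frac{1-2x+2x^2-\sqrt{1-4x+4x^2-4x^3+4x^4}}{2x^2}.$
   Context: $S_n$ is the set of permutations of $[n]$ ($S_0$ contains only the empty permutation); $\operatorname{Av}_n(231,321)$ is the set of $\pi\in S_n$ having no subsequence in the same relative order as $231$ or as $321$. Valid hook configurations. For $\pi=\pi_1\cdots\pi_n$, a descent is $i\in[n-1]$ with $\pi_i>\pi_{i+1}$, and $(i,\pi_i)$ is a descent top of the plot $\{(i,\pi_i)\}$. A hook is determined by $i<j$ with $\pi_i<\pi_j$: vertical segment from $(i,\pi_i)$ up to $(i,\pi_j)$, then horizontal segment to $(j,\pi_j)$; southwest endpoint $(i,\pi_i)$, northeast endpoint $(j,\pi_j)$. If $\pi$ has descents $d_1<\cdots<d_k$, a valid hook configuration is a tuple $(H_1,\dots,H_k)$ of hooks such that (1) $H_i$ has southwest endpoint $(d_i,\pi_{d_i})$; (2) no point of the plot lies directly above a hook; (3) hooks do not intersect or overlap except that the northeast endpoint of one may be the southwest endpoint of another. $\mathrm{VHC}(\pi)$ is the set of these (configurations of distinct permutations are distinct; an increasing permutation, including the empty one, has exactly one, with no hooks); $\mathrm{VHC}(A)=\bigcup_{\pi\in A}\mathrm{VHC}(\pi)$. *)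

theory Defs
  imports
    Complex_Main
    "HOL-Library.Sublist"
    "HOL-Combinatorics.Multiset_Permutations"
    "HOL-Computational_Algebra.Formal_Power_Series"
begin

text \<open>
  A permutation of \<open>{1..n}\<close> is a list in one-line notation, i.e. an element of
  \<^term>\<open>permutations_of_set {1..n::nat}\<close>.  Positions are list indices and hence start
  at 0, so the plot of a permutation is shifted one unit to the left of the usual one.
\<close>

definition same_relative_order :: "nat list \<Rightarrow> nat list \<Rightarrow> bool" where
  "same_relative_order u v \<longleftrightarrow>
     length u = length v \<and>
     (\<forall>a<length u. \<forall>b<length u. u ! a < u ! b \<longleftrightarrow> v ! a < v ! b)"

definition avoids :: "nat list \<Rightarrow> nat list \<Rightarrow> bool" where
  "avoids \<pi> \<sigma> \<longleftrightarrow> \<not> (\<exists>u. subseq u \<pi> \<and> same_relative_order u \<sigma>)"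

definition Av :: "nat \<Rightarrow> nat list set \<Rightarrow> nat list set" where
  "Av n T = {\<pi> \<in> permutations_of_set {1..n}. \<forall>\<sigma>\<in>T. avoids \<pi> \<sigma>}"

definition descents :: "nat list \<Rightarrow> nat set" where
  "descents \<pi> = {i. Suc i < length \<pi> \<and> \<pi> ! i > \<pi> ! Suc i}"

definition plot_point :: "nat list \<Rightarrow> nat \<Rightarrow> real \<times> real" where
  "plot_point \<pi> i = (real i, real (\<pi> ! i))"

text \<open>
  A hook is encoded by the pair of positions \<open>(i, j)\<close> of its southwest and northeast endpoints;
  \<open>hook_points\<close> is the subset of the plane that it occupies.
\<close>

type_synonym hook = "nat \<times> nat"

definition is_hook :: "nat list \<Rightarrow> hook \<Rightarrow> bool" where
  "is_hook \<pi> h \<longleftrightarrow> fst h < snd h \<and> snd h < length \<pi> \<and> \<pi> ! fst h < \<pi> ! snd h"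

definition southwest :: "nat list \<Rightarrow> hook \<Rightarrow> real \<times> real" where
  "southwest \<pi> h = plot_point \<pi> (fst h)"

definition northeast :: "nat list \<Rightarrow> hook \<Rightarrow> real \<times> real" where
  "northeast \<pi> h = plot_point \<pi> (snd h)"

definition hook_points :: "nat list \<Rightarrow> hook \<Rightarrow> (real \<times> real) set" where
  "hook_points \<pi> h =
     {real (fst h)} \<times> {real (\<pi> ! fst h)..real (\<pi> ! snd h)} \<union>
     {real (fst h)..real (snd h)} \<times> {real (\<pi> ! snd h)}"

definition directly_above :: "real \<times> real \<Rightarrow> (real \<times> real) set \<Rightarrow> bool" where
  "directly_above P S \<longleftrightarrow> (\<exists>y < snd P. (fst P, y) \<in> S)"

definition valid_hook_configuration :: "nat list \<Rightarrow> hook list \<Rightarrow> bool" where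
  "valid_hook_configuration \<pi> H \<longleftrightarrow>
     (\<forall>h\<in>set H. is_hook \<pi> h) \<and>
     map fst H = sorted_list_of_set (descents \<pi>) \<and>
     (\<forall>h\<in>set H. \<forall>i<length \<pi>. \<not> directly_above (plot_point \<pi> i) (hook_points \<pi> h)) \<and>
     (\<forall>a<length H. \<forall>b<length H. a \<noteq> b \<longrightarrow>
        (\<forall>P \<in> hook_points \<pi> (H ! a) \<inter> hook_points \<pi> (H ! b).
           P = northeast \<pi> (H ! a) \<and> P = southwest \<pi> (H ! b) \<or>
           P = northeast \<pi> (H ! b) \<and> P = southwest \<pi> (H ! a)))"

text \<open>
  The permutation is kept as a component, so that configurations of distinct permutations
  are distinct.
\<close>

definition VHC :: "nat list \<Rightarrow> (nat list \<times> hook list) set" where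
  "VHC \<pi> = {(\<pi>, H) | H. valid_hook_configuration \<pi> H}"

definition VHC_set :: "nat list set \<Rightarrow> (nat list \<times> hook list) set" where
  "VHC_set A = (\<Union>\<pi>\<in>A. VHC \<pi>)"

text \<open>
  The power series with constant coefficient 1 whose square is \<open>f\<close>, for \<open>f\<close> with constant
  coefficient 1.
\<close>

abbreviation fps_sqrt :: "real fps \<Rightarrow> real fps" where
  "fps_sqrt f \<equiv> fps_radical root 2 f"

end

theory Submission imports Defs begin

text \<open>
  A permutation avoids 231 and 321 iff every entry has at most one larger entry before it, i.e. iff
  it is a direct sum of blocks \<open>k 1 2 \<dots> (k - 1)\<close>; its descent tops are the first entries of the
  blocks of size at least 2, and its left-to-right maxima are the first entries of all blocks.  As
  no point lies above a hook, every northeast endpoint is a left-to-right maximum, so hooks join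
  block starts, and the hooks of a configuration form a noncrossing system of arcs.  Cutting a
  configuration at the end of the hook of its first block gives \<open>F = 1 + x F + y F (F - 1)\<close> with
  \<open>y = x\<^sup>2 / (1 - x)\<close> accounting for the size of the first block.
\<close>

section \<open>Permutations avoiding 231 and 321\<close>

text \<open>The list holds the block sizes, and \<open>s\<close> counts the entries of earlier
  blocks. A size \<open>0\<close> would still emit an entry, hence the recurring hypothesis
  \<open>0 \<notin> set c\<close>.\<close>

fun block_perm :: "nat \<Rightarrow> nat list \<Rightarrow> nat list" where
  "block_perm s [] = []"
| "block_perm s (k # c) = (s + k) # [Suc s..<s + k] @ block_perm (s + k) c"

definition at_most_one_larger_before :: "nat list \<Rightarrow> bool" where
  "at_most_one_larger_before xs \<longleftrightarrow> (\<forall>a b c. subseq [a, b, c] xs \<longrightarrow> \<not> (c < a \<and> c < b))"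

section \<open>Pattern avoidance as a condition on triples\<close>

lemma all_less_3: "(\<forall>i<3. P i) \<longleftrightarrow> P 0 \<and> P 1 \<and> P (2 :: nat)"
  by (auto simp: less_Suc_eq eval_nat_numeral)

lemma same_relative_order_3:
  "same_relative_order u [x, y, z] \<longleftrightarrow>
    (\<exists>a b c. u = [a, b, c] \<and> (a < b \<longleftrightarrow> x < y) \<and> (b < a \<longleftrightarrow> y < x) \<and> (a < c \<longleftrightarrow> x < z) \<and>
      (c < a \<longleftrightarrow> z < x) \<and> (b < c \<longleftrightarrow> y < z) \<and> (c < b \<longleftrightarrow> z < y))"
proof (cases "length u = 3")
  case True
  then obtain a b c where "u = [a, b, c]"
    by (auto simp: eval_nat_numeral length_Suc_conv)
  moreover have "length [a, b, c] = 3" "length [x, y, z] = 3"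
    by simp_all
  ultimately show ?thesis
    unfolding same_relative_order_def by (simp only: all_less_3) auto
qed (auto simp: same_relative_order_def)

lemma same_relative_order_231: "same_relative_order u [2, 3, 1] \<longleftrightarrow> (\<exists>a b c. u = [a, b, c] \<and> c < a \<and> a < b)"
  by (auto simp: same_relative_order_3)

lemma same_relative_order_321: "same_relative_order u [3, 2, 1] \<longleftrightarrow> (\<exists>a b c. u = [a, b, c] \<and> c < b \<and> b < a)"
  by (auto simp: same_relative_order_3)

text \<open>With distinct entries, two entries larger than a later third one are either increasing,
  giving 231, or decreasing, giving 321.\<close>

lemma avoids_231_321_iff:
  assumes "distinct xs"
  shows "avoids xs [2, 3, 1] \<and> avoids xs [3, 2, 1] \<longleftrightarrow> at_most_one_larger_before xs"
proof -
  have "a \<noteq> b" if "subseq [a, b, c] xs" for a b c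
    using that assms distinct_nthsI unfolding subseq_conv_nths by (metis distinct_length_2_or_more)
  then show ?thesis
    unfolding avoids_def same_relative_order_231 same_relative_order_321 at_most_one_larger_before_def
    by (metis less_trans linorder_neqE_nat)
qed

lemma at_most_one_larger_before_subseq:
  "at_most_one_larger_before ys" if "at_most_one_larger_before xs" "subseq ys xs"
  using that unfolding at_most_one_larger_before_def by (meson subseq_order.trans)

lemma at_most_one_larger_before_append:
  assumes "at_most_one_larger_before xs" "at_most_one_larger_before ys"
    and "\<And>x y. x \<in> set xs \<Longrightarrow> y \<in> set ys \<Longrightarrow> x < y"
  shows "at_most_one_larger_before (xs @ ys)"
  unfolding at_most_one_larger_before_def
proof (intro allI impI)
  fix a b c
  assume "subseq [a, b, c] (xs @ ys)"
  then obtain u v where uv: "[a, b, c] = u @ v" "subseq u xs" "subseq v ys"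
    unfolding subseq_append_iff by blast
  have sub: "set u \<subseteq> set xs" "set v \<subseteq> set ys"
    using uv by (auto dest: list_emb_set)
  show "\<not> (c < a \<and> c < b)"
  proof (cases "u = [] \<or> v = []")
    case True
    then have "subseq [a, b, c] xs \<or> subseq [a, b, c] ys"
      using uv by (metis append_Nil append_Nil2)
    then show ?thesis
      using assms(1,2) unfolding at_most_one_larger_before_def by blast
  next
    \<comment> \<open>A triple meeting both parts starts in \<open>xs\<close> and ends in
      \<open>ys\<close>, so its last entry exceeds its first.\<close>
    case False
    then have "hd u = a" "last v = c"
      using arg_cong[OF uv(1), of hd] arg_cong[OF uv(1), of last] by auto
    with False have "a \<in> set u" "c \<in> set v"
      using hd_in_set last_in_set by blast+
    then show ?thesis
      using sub assms(3) by (meson less_asym subsetD)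
  qed
qed

text \<open>The last two entries of any such triple lie in the sorted part, so the middle one cannot
  exceed the last.\<close>

lemma at_most_one_larger_before_Cons_sorted:
  assumes "sorted xs"
  shows "at_most_one_larger_before (m # xs)"
  unfolding at_most_one_larger_before_def
proof (intro allI impI)
  fix a b c
  assume "subseq [a, b, c] (m # xs)"
  then have "subseq [b, c] xs"
    by (cases "a = m") (auto dest: subseq_Cons')
  then have "b \<le> c"
    using assms sorted_nths unfolding subseq_conv_nths by (metis sorted2)
  then show "\<not> (c < a \<and> c < b)"
    by simp
qed

section \<open>Block permutations and compositions\<close>

lemma length_block_perm: "0 \<notin> set c \<Longrightarrow> length (block_perm s c) = sum_list c"
  by (induction c arbitrary: s) auto

lemma set_block_perm: "0 \<notin> set c \<Longrightarrow> set (block_perm s c) = {Suc s..s + sum_list c}"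
  by (induction c arbitrary: s) auto

lemma distinct_block_perm: "0 \<notin> set c \<Longrightarrow> distinct (block_perm s c)"
  by (induction c arbitrary: s) (auto simp: set_block_perm)

lemma at_most_one_larger_before_block_perm:
  "0 \<notin> set c \<Longrightarrow> at_most_one_larger_before (block_perm s c)"
proof (induction c arbitrary: s)
  case Nil
  then show ?case
    by (simp add: at_most_one_larger_before_def)
next
  case (Cons k c)
  have "at_most_one_larger_before (((s + k) # [Suc s..<s + k]) @ block_perm (s + k) c)"
  proof (rule at_most_one_larger_before_append)
    show "at_most_one_larger_before (block_perm (s + k) c)"
      using Cons.prems by (intro Cons.IH) simp
    show "x < y" if "x \<in> set ((s + k) # [Suc s..<s + k])" "y \<in> set (block_perm (s + k) c)" for x y
      using that Cons.prems by (auto simp: set_block_perm)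
  qed (rule at_most_one_larger_before_Cons_sorted, simp)
  then show ?case
    by (simp only: block_perm.simps append_Cons)
qed

text \<open>The first entry \<open>s + k\<close> reveals the size of the first block; the rest
  follows by induction.\<close>

lemma block_perm_inject:
  "0 \<notin> set c \<Longrightarrow> 0 \<notin> set d \<Longrightarrow> block_perm s c = block_perm s d \<Longrightarrow> c = d"
proof (induction c arbitrary: s d)
  case (Nil s d)
  then show ?case by (cases d) simp_all
next
  case (Cons k c)
  from Cons.prems(3) obtain d' where d: "d = k # d'"
    by (cases d) auto
  with Cons.prems(3) have "block_perm (s + k) c = block_perm (s + k) d'"
    by simp
  from Cons.IH[OF _ _ this] Cons.prems(1,2) show ?case
    by (simp add: d)
qed

text \<open>
  The least entry is in one of the first two positions.  If it comes first it is a block of size 1;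
  otherwise deleting it shortens the first block.
\<close>

lemma block_perm_if_at_most_one_larger_before:
  assumes "at_most_one_larger_before xs" "distinct xs" "set xs = {Suc s..s + n}"
  shows "\<exists>c. 0 \<notin> set c \<and> sum_list c = n \<and> xs = block_perm s c"
  using assms
proof (induction n arbitrary: s xs)
  case 0
  then show ?case by (intro exI[of _ "[]"]) auto
next
  case (Suc n)
  have interval: "{Suc s..s + Suc n} = insert (Suc s) {Suc (Suc s)..Suc s + n}"
    by auto
  have "Suc s \<in> set xs"
    using Suc.prems by auto
  then obtain us zs where xs: "xs = us @ Suc s # zs"
    by (auto simp: in_set_conv_decomp)
  have us_gt: "Suc s < u" if "u \<in> set us" for u
    using that Suc.prems(2,3) unfolding xs by (metis (no_types, lifting) Un_iff atLeastAtMost_iff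
        distinct_append insert_iff disjoint_iff le_neq_implies_less list.set(2) set_append)
  consider "us = []" | m where "us = [m]" | a b ws where "us = a # b # ws"
    by (metis neq_Nil_conv)
  then show ?case
  proof cases
    case 1
    have "set zs = {Suc (Suc s)..Suc s + n}"
      using Suc.prems(2,3) unfolding xs 1 interval by (simp add: insert_ident)
    moreover have "at_most_one_larger_before zs"
      using Suc.prems(1) by (rule at_most_one_larger_before_subseq) (auto simp: xs 1)
    moreover have "distinct zs"
      using Suc.prems(2) by (simp add: xs)
    ultimately obtain c where c: "0 \<notin> set c" "sum_list c = n" "zs = block_perm (Suc s) c"
      using Suc.IH[of zs "Suc s"] by blast
    then have "xs = block_perm s (1 # c)"
      by (simp add: xs 1)
    with c(1,2) show ?thesis
      by (intro exI[of _ "1 # c"]) simp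
  next
    case (2 m)
    have "set (m # zs) = {Suc (Suc s)..Suc s + n}"
    proof -
      have "insert (Suc s) (set (m # zs)) = insert (Suc s) {Suc (Suc s)..Suc s + n}"
        using Suc.prems(3) unfolding xs 2 interval by auto
      then show ?thesis
        by (subst (asm) insert_ident) (use Suc.prems(2) in \<open>auto simp: xs 2\<close>)
    qed
    moreover have "at_most_one_larger_before (m # zs)"
      using Suc.prems(1) by (rule at_most_one_larger_before_subseq) (auto simp: xs 2)
    moreover have "distinct (m # zs)"
      using Suc.prems(2) by (simp add: xs 2)
    ultimately obtain c where c: "0 \<notin> set c" "sum_list c = n" "m # zs = block_perm (Suc s) c"
      using Suc.IH[of "m # zs" "Suc s"] by blast
    then obtain k c' where "c = k # c'"
      by (cases c) auto
    \<comment> \<open>As \<open>k\<close> is positive, \<open>[Suc s..<s + Suc k]\<close> begins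
      with \<open>Suc s\<close>; the leading entry is \<open>m = Suc s + k = s + Suc k\<close> for
      both compositions.\<close>
    with c have "xs = block_perm s (Suc k # c')"
      by (simp add: xs 2 upt_conv_Cons)
    with c(1,2) \<open>c = k # c'\<close> show ?thesis
      by (intro exI[of _ "Suc k # c'"]) simp
  next
    case (3 a b ws)
    have "subseq [a, b, Suc s] xs"
      unfolding xs 3 by (simp add: list_emb_append2)
    moreover have "Suc s < a" "Suc s < b"
      using us_gt by (simp_all add: 3)
    ultimately show ?thesis
      using Suc.prems(1) unfolding at_most_one_larger_before_def by blast
  qed
qed

definition compositions :: "nat \<Rightarrow> nat list set" where
  "compositions n = {c. 0 \<notin> set c \<and> sum_list c = n}"

lemma Av_231_321: "Av n {[2, 3, 1], [3, 2, 1]} = block_perm 0 ` compositions n"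
proof (intro equalityI subsetI)
  fix xs
  assume "xs \<in> Av n {[2, 3, 1], [3, 2, 1]}"
  then have "at_most_one_larger_before xs" "distinct xs" "set xs = {Suc 0..0 + n}"
    using avoids_231_321_iff by (auto simp: Av_def permutations_of_set_def)
  then show "xs \<in> block_perm 0 ` compositions n"
    using block_perm_if_at_most_one_larger_before[of xs 0 n] by (auto simp: compositions_def)
next
  fix xs
  assume "xs \<in> block_perm 0 ` compositions n"
  then obtain c where "0 \<notin> set c" "sum_list c = n" "xs = block_perm 0 c"
    by (auto simp: compositions_def)
  then show "xs \<in> Av n {[2, 3, 1], [3, 2, 1]}"
    using avoids_231_321_iff[of xs] distinct_block_perm[of c 0] set_block_perm[of c 0]
      at_most_one_larger_before_block_perm[of c 0]
    by (auto simp: Av_def permutations_of_set_def)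
qed

section \<open>Hook configurations as noncrossing arcs\<close>

text \<open>Positions count from 0 and values from 1, so a block preceded by \<open>s\<close>
  entries starts at position \<open>s\<close> and has least value \<open>Suc s\<close>; one offset
  serves both.\<close>

fun block_starts :: "nat \<Rightarrow> nat list \<Rightarrow> nat list" where
  "block_starts s [] = []"
| "block_starts s (k # c) = s # block_starts (s + k) c"

text \<open>A list rather than a set, because a configuration lists its hooks in increasing order of
  descent.\<close>

fun block_descents :: "nat \<Rightarrow> nat list \<Rightarrow> nat list" where
  "block_descents s [] = []"
| "block_descents s (k # c) = (if 2 \<le> k then [s] else []) @ block_descents (s + k) c"

section \<open>Left-to-right maxima and descents by position\<close>

lemma block_starts_bounds:
  "0 \<notin> set c \<Longrightarrow> i \<in> set (block_starts s c) \<Longrightarrow> s \<le> i \<and> i < s + sum_list c"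
  by (induction c arbitrary: s) fastforce+

lemma block_descents_subset: "set (block_descents s c) \<subseteq> set (block_starts s c)"
  by (induction c arbitrary: s) auto

lemma sorted_block_descents: "0 \<notin> set c \<Longrightarrow> sorted_wrt (<) (block_descents s c)"
proof (induction c arbitrary: s)
  case (Cons k c)
  then show ?case
    using block_descents_subset[of "s + k" c] block_starts_bounds[of c _ "s + k"] by fastforce
qed simp

text \<open>The first entry of a block is the largest of its block and exceeds all earlier blocks;
  every other entry is below the first entry of its own block.\<close>

lemma block_starts_iff_left_to_right_max:
  assumes "0 \<notin> set c" "i < sum_list c"
  shows "s + i \<in> set (block_starts s c) \<longleftrightarrow> (\<forall>q<i. block_perm s c ! q < block_perm s c ! i)"
  using assms
proof (induction c arbitrary: s i)
  case (Cons k c)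
  define xs where "xs = (s + k) # [Suc s..<s + k]"
  have len: "length xs = k"
    using Cons.prems by (auto simp: xs_def)
  have xs_le: "xs ! q \<le> s + k" if "q < k" for q
    using that by (cases q) (auto simp: xs_def nth_upt)
  have perm: "block_perm s (k # c) = xs @ block_perm (s + k) c"
    by (simp add: xs_def)
  show ?case
  proof (cases "i < k")
    case True
    have "s + i \<notin> set (block_starts (s + k) c)"
      using True Cons.prems block_starts_bounds[of c "s + i" "s + k"] by auto
    moreover have "xs ! i < xs ! 0" if "i \<noteq> 0"
      using True that by (cases i) (auto simp: xs_def nth_upt)
    ultimately show ?thesis
      using True unfolding perm by (cases "i = 0") (auto simp: nth_append len intro!: exI[of _ 0])
  next
    case False
    define j where "j = i - k"
    have i: "i = k + j" and j: "j < sum_list c"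
      using False Cons.prems by (auto simp: j_def)
    have "block_perm (s + k) c ! j \<in> set (block_perm (s + k) c)"
      using j Cons.prems by (intro nth_mem) (auto simp: length_block_perm)
    then have gt: "s + k < block_perm (s + k) c ! j"
      using Cons.prems by (auto simp: set_block_perm)
    \<comment> \<open>Entries of the first block are at most \<open>s + k\<close>, below all later
      ones, so only competitors from the remaining blocks matter.\<close>
    have "(\<forall>q<i. block_perm s (k # c) ! q < block_perm s (k # c) ! i) \<longleftrightarrow>
        (\<forall>q<j. block_perm (s + k) c ! q < block_perm (s + k) c ! j)"
    proof (intro iffI allI impI)
      fix q assume *: "\<forall>q<i. block_perm s (k # c) ! q < block_perm s (k # c) ! i" and "q < j"
      then show "block_perm (s + k) c ! q < block_perm (s + k) c ! j"
        using spec[OF *, of "k + q"] unfolding perm by (simp add: nth_append len i)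
    next
      fix q assume *: "\<forall>q<j. block_perm (s + k) c ! q < block_perm (s + k) c ! j" and "q < i"
      then show "block_perm s (k # c) ! q < block_perm s (k # c) ! i"
        using spec[OF *, of "q - k"] xs_le[of q] gt unfolding perm
        by (auto simp: nth_append len i)
    qed
    then show ?thesis
      using Cons.IH[of j "s + k"] Cons.prems j by (auto simp: i add.assoc)
  qed
qed simp

text \<open>Within a block the only step down follows its first entry, and values rise from each
  block to the next.\<close>

lemma block_descents_iff:
  assumes "0 \<notin> set c" "i < sum_list c"
  shows "s + i \<in> set (block_descents s c) \<longleftrightarrow>
    Suc i < sum_list c \<and> block_perm s c ! Suc i < block_perm s c ! i"
  using assms
proof (induction c arbitrary: s i)
  case (Cons k c)
  define xs where "xs = (s + k) # [Suc s..<s + k]"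
  have len: "length xs = k"
    using Cons.prems by (auto simp: xs_def)
  have perm: "block_perm s (k # c) = xs @ block_perm (s + k) c"
    by (simp add: xs_def)
  have gt: "s + k < block_perm (s + k) c ! j" if "j < sum_list c" for j
  proof -
    have "block_perm (s + k) c ! j \<in> set (block_perm (s + k) c)"
      using that Cons.prems by (intro nth_mem) (auto simp: length_block_perm)
    then show ?thesis
      using Cons.prems by (auto simp: set_block_perm)
  qed
  show ?case
  proof (cases "i < k")
    case True
    have "s + i \<notin> set (block_descents (s + k) c)"
      using True Cons.prems block_descents_subset[of "s + k" c]
        block_starts_bounds[of c "s + i" "s + k"] by auto
    moreover have "Suc i < k \<Longrightarrow> xs ! Suc i < xs ! i \<longleftrightarrow> i = 0"
      by (cases i) (auto simp: xs_def nth_upt)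
    moreover have "xs ! i \<le> s + k"
      using True by (cases i) (auto simp: xs_def nth_upt)
    \<comment> \<open>At the last position of the block, \<open>Suc i = k\<close>, the next entry,
      if any, opens the next block and is larger; this is \<open>gt[of 0]\<close>.\<close>
    ultimately show ?thesis
      using True gt[of 0] unfolding perm by (cases "Suc i = k") (auto simp: nth_append len)
  next
    case False
    define j where "j = i - k"
    have i: "i = k + j" and j: "j < sum_list c"
      using False Cons.prems by (auto simp: j_def)
    then show ?thesis
      using Cons.IH[of j "s + k"] Cons.prems unfolding perm by (auto simp: i add.assoc nth_append len)
  qed
qed simp

text \<open>Meant for arcs listed by left endpoint. An arc may start where an earlier one ends, but
  two nested arcs may not share their right endpoint, since their horizontal segments would
  overlap.\<close>

definition noncrossing :: "hook list \<Rightarrow> bool" where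
  "noncrossing H \<longleftrightarrow> sorted_wrt (\<lambda>h h'. fst h' < snd h \<longrightarrow> snd h' < snd h) H"

text \<open>Hooks stripped of their geometry. The offset \<open>s\<close> lets the pieces of a
  system that is cut keep their absolute positions.\<close>

definition arc_system :: "nat \<Rightarrow> nat list \<Rightarrow> hook list \<Rightarrow> bool" where
  "arc_system s c H \<longleftrightarrow>
     map fst H = block_descents s c \<and>
     (\<forall>h\<in>set H. fst h < snd h \<and> snd h \<in> set (block_starts s c)) \<and>
     noncrossing H"

section \<open>From hooks in the plane to arcs\<close>

lemma hook_points_iff:
  "(x, y) \<in> hook_points \<pi> (i, j) \<longleftrightarrow>
     x = real i \<and> real (\<pi> ! i) \<le> y \<and> y \<le> real (\<pi> ! j) \<or>
     real i \<le> x \<and> x \<le> real j \<and> y = real (\<pi> ! j)"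
  by (auto simp: hook_points_def)

lemma valid_hook_configuration_block_perm:
  assumes c: "0 \<notin> set c"
  shows "valid_hook_configuration (block_perm 0 c) H \<longleftrightarrow> arc_system 0 c H"
proof -
  define \<pi> where "\<pi> = block_perm 0 c"
  define S where "S = set (block_starts 0 c)"
  have len: "length \<pi> = sum_list c"
    using c by (simp add: \<pi>_def length_block_perm)
  have S_iff: "i \<in> S \<longleftrightarrow> i < length \<pi> \<and> (\<forall>q<i. \<pi> ! q < \<pi> ! i)" for i
    using block_starts_iff_left_to_right_max[OF c, of i 0] block_starts_bounds[OF c, of i 0]
    unfolding S_def \<pi>_def[symmetric] len by auto
  have "descents \<pi> = set (block_descents 0 c)"
  proof (intro set_eqI)
    fix i
    show "i \<in> descents \<pi> \<longleftrightarrow> i \<in> set (block_descents 0 c)"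
      using block_descents_iff[OF c, of i 0] block_starts_bounds[OF c, of i 0]
        block_descents_subset[of 0 c] len
      unfolding descents_def \<pi>_def[symmetric] by auto
  qed
  then have desc: "sorted_list_of_set (descents \<pi>) = block_descents 0 c"
    using sorted_block_descents[OF c, of 0]
    by (metis sorted_list_of_set.idem_if_sorted_distinct strict_sorted_iff)
  have fst_S: "fst h \<in> S" if "map fst H = block_descents 0 c" "h \<in> set H" for h
  proof -
    have "fst h \<in> set (map fst H)"
      using that(2) by simp
    then show ?thesis
      using that(1) block_descents_subset[of 0 c] unfolding S_def by (metis subsetD)
  qed

  \<comment> \<open>Suppose an earlier point exceeds the northeast endpoint. It cannot be at or
    before \<open>i\<close>, since \<open>i\<close> is a left-to-right maximum below
    \<open>\<pi> ! j\<close>; hence it lies above the horizontal segment. Conversely, nothing up to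
    \<open>j\<close> rises above a left-to-right maximum at \<open>j\<close>.\<close>
  have endpoint: "is_hook \<pi> (i, j) \<and>
      (\<forall>r<length \<pi>. \<not> directly_above (plot_point \<pi> r) (hook_points \<pi> (i, j))) \<longleftrightarrow>
      i < j \<and> j \<in> S" if "i \<in> S" for i j
  proof (intro iffI conjI allI impI)
    assume *: "is_hook \<pi> (i, j) \<and>
      (\<forall>r<length \<pi>. \<not> directly_above (plot_point \<pi> r) (hook_points \<pi> (i, j)))"
    then show "i < j"
      by (simp add: is_hook_def)
    have ij: "j < length \<pi>" "\<pi> ! i < \<pi> ! j"
      using * by (auto simp: is_hook_def)
    have "\<pi> ! q < \<pi> ! j" if "q < j" for q
    proof (rule ccontr)
      assume "\<not> ?thesis"
      moreover have "distinct \<pi>"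
        using c by (simp add: \<pi>_def distinct_block_perm)
      then have "\<pi> ! q \<noteq> \<pi> ! j"
        using \<open>q < j\<close> ij(1) by (simp add: nth_eq_iff_index_eq)
      ultimately have gt: "\<pi> ! j < \<pi> ! q"
        by simp
      have "\<not> q < i" "q \<noteq> i"
        using gt ij(2) \<open>i \<in> S\<close> unfolding S_iff by (meson less_asym less_trans, auto)
      then have "i < q"
        by simp
      then have "directly_above (plot_point \<pi> q) (hook_points \<pi> (i, j))"
        using gt \<open>q < j\<close> unfolding directly_above_def plot_point_def
        by (intro exI[of _ "real (\<pi> ! j)"]) (auto simp: hook_points_iff)
      then show False
        using * \<open>q < j\<close> ij(1) by auto
    qed
    then show "j \<in> S"
      using ij(1) by (simp add: S_iff)
  next
    assume "i < j \<and> j \<in> S"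
    then show "is_hook \<pi> (i, j)"
      by (simp add: is_hook_def S_iff)
  next
    fix r
    assume ij: "i < j \<and> j \<in> S" and "r < length \<pi>"
    have "\<pi> ! r \<le> \<pi> ! j" if "r \<le> j"
      using that ij unfolding S_iff by (cases "r = j") (auto simp: less_imp_le)
    then show "\<not> directly_above (plot_point \<pi> r) (hook_points \<pi> (i, j))"
      using ij by (auto simp: directly_above_def plot_point_def hook_points_iff)
  qed

  have crossing: "(\<forall>P \<in> hook_points \<pi> (i, j) \<inter> hook_points \<pi> (i', j').
        P = northeast \<pi> (i, j) \<and> P = southwest \<pi> (i', j') \<or>
        P = northeast \<pi> (i', j') \<and> P = southwest \<pi> (i, j)) \<longleftrightarrow>
      (i' < j \<longrightarrow> j' < j)" (is "?L \<longleftrightarrow> ?R")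
    if "i < i'" "i < j" "i' < j'" "i' \<in> S" "j \<in> S" "j' \<in> S" for i j i' j'
  proof
    assume L: ?L
    show ?R
    proof (rule ccontr)
      assume "\<not> ?R"
      then have *: "i' < j" "j \<le> j'"
        by auto
      have "\<pi> ! i' < \<pi> ! j" "\<pi> ! j \<le> \<pi> ! j'"
        using * that unfolding S_iff by (auto simp: le_less)
      \<comment> \<open>Values increase along \<open>S\<close>, so the vertical segment of the
        second hook reaches the horizontal segment of the first. The common point lies strictly left
        of both northeast endpoints.\<close>
      then have "(real i', real (\<pi> ! j)) \<in> hook_points \<pi> (i, j) \<inter> hook_points \<pi> (i', j')"
        using * that by (auto simp: hook_points_iff)
      from bspec[OF L this] show False
        using * that by (auto simp: northeast_def southwest_def plot_point_def)
    qed
  next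
    assume R: ?R
    show ?L
    proof
      fix P
      assume P: "P \<in> hook_points \<pi> (i, j) \<inter> hook_points \<pi> (i', j')"
      obtain x y where xy: "P = (x, y)"
        by fastforce
      \<comment> \<open>A common point is to the right of column \<open>i\<close>, hence on the
        horizontal segment of the first hook.\<close>
      have x: "real i' \<le> x" "x \<le> real j" and y: "y = real (\<pi> ! j)"
        using P that unfolding xy by (auto simp: hook_points_iff)
      \<comment> \<open>Otherwise the second hook ends before \<open>j\<close> and stays strictly
        below the height \<open>\<pi> ! j\<close>.\<close>
      have "\<not> i' < j"
      proof
        assume "i' < j"
        with R that have "\<pi> ! j' < \<pi> ! j"
          by (simp add: S_iff)
        moreover have "y \<le> real (\<pi> ! j')"
          using P unfolding xy by (auto simp: hook_points_iff)
        ultimately show False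
          using y by simp
      qed
      with x have "i' = j" "x = real j"
        by auto
      then show "P = northeast \<pi> (i, j) \<and> P = southwest \<pi> (i', j') \<or>
        P = northeast \<pi> (i', j') \<and> P = southwest \<pi> (i, j)"
        using xy y by (simp add: northeast_def southwest_def plot_point_def)
    qed
  qed

  define meet where "meet = (\<lambda>h h'. \<forall>P \<in> hook_points \<pi> h \<inter> hook_points \<pi> h'.
      P = northeast \<pi> h \<and> P = southwest \<pi> h' \<or> P = northeast \<pi> h' \<and> P = southwest \<pi> h)"
  have valid: "valid_hook_configuration \<pi> H \<longleftrightarrow> map fst H = block_descents 0 c \<and>
      (\<forall>h\<in>set H. is_hook \<pi> h \<and>
        (\<forall>r<length \<pi>. \<not> directly_above (plot_point \<pi> r) (hook_points \<pi> h))) \<and>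
      (\<forall>a<length H. \<forall>b<length H. a \<noteq> b \<longrightarrow> meet (H ! a) (H ! b))"
    unfolding valid_hook_configuration_def desc meet_def by blast
  have arcs: "arc_system 0 c H \<longleftrightarrow> map fst H = block_descents 0 c \<and>
      (\<forall>h\<in>set H. fst h < snd h \<and> snd h \<in> S) \<and> noncrossing H"
    unfolding arc_system_def S_def ..
  have endpoints: "(\<forall>h\<in>set H. is_hook \<pi> h \<and>
        (\<forall>r<length \<pi>. \<not> directly_above (plot_point \<pi> r) (hook_points \<pi> h))) \<longleftrightarrow>
      (\<forall>h\<in>set H. fst h < snd h \<and> snd h \<in> S)" if "map fst H = block_descents 0 c"
    using endpoint[OF fst_S[OF that]] by (intro ball_cong refl) (metis prod.collapse)
  \<comment> \<open>Validity speaks of all ordered pairs, \<open>noncrossing\<close> only of pairs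
    in list order, which is the order of left endpoints; the symmetry of \<open>meet\<close> closes
    the gap.\<close>
  have crossings: "(\<forall>a<length H. \<forall>b<length H. a \<noteq> b \<longrightarrow> meet (H ! a) (H ! b)) \<longleftrightarrow> noncrossing H"
    if "map fst H = block_descents 0 c" and S: "\<forall>h\<in>set H. fst h < snd h \<and> snd h \<in> S"
  proof -
    have meet: "meet (H ! a) (H ! b) \<longleftrightarrow> (fst (H ! b) < snd (H ! a) \<longrightarrow> snd (H ! b) < snd (H ! a))"
      if "a < b" "b < length H" for a b
    proof -
      have "sorted_wrt (<) (map fst H)"
        using \<open>map fst H = _\<close> sorted_block_descents[OF c] by simp
      then have "fst (H ! a) < fst (H ! b)"
        using that sorted_wrt_nth_less[of "(<)" "map fst H" a b] by simp
      moreover have "H ! a \<in> set H" "H ! b \<in> set H"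
        using that by auto
      ultimately show ?thesis
        using crossing[of "fst (H ! a)" "fst (H ! b)" "snd (H ! a)" "snd (H ! b)"] S
          fst_S[OF \<open>map fst H = _\<close>]
        unfolding meet_def by simp
    qed
    show ?thesis
    proof
      assume "\<forall>a<length H. \<forall>b<length H. a \<noteq> b \<longrightarrow> meet (H ! a) (H ! b)"
      then show "noncrossing H"
        unfolding noncrossing_def sorted_wrt_iff_nth_less using meet by simp
    next
      assume "noncrossing H"
      then have less: "meet (H ! a) (H ! b)" if "a < b" "b < length H" for a b
        using that meet unfolding noncrossing_def sorted_wrt_iff_nth_less by blast
      have sym: "meet h h' \<Longrightarrow> meet h' h" for h h'
        unfolding meet_def by blast
      show "\<forall>a<length H. \<forall>b<length H. a \<noteq> b \<longrightarrow> meet (H ! a) (H ! b)"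
      proof (intro allI impI)
        fix a b
        assume "a < length H" "b < length H" "a \<noteq> b"
        then show "meet (H ! a) (H ! b)"
          using less[of a b] sym[OF less[of b a]] by (cases "a < b") auto
      qed
    qed
  qed
  show ?thesis
    unfolding \<pi>_def[symmetric] valid arcs using endpoints crossings by blast
qed

section \<open>Counting arc systems\<close>

definition arc_systems :: "nat \<Rightarrow> nat \<Rightarrow> (nat list \<times> hook list) set" where
  "arc_systems s n = {(c, H). c \<in> compositions n \<and> arc_system s c H}"

lemma card_VHC_set: "card (VHC_set (Av n {[2, 3, 1], [3, 2, 1]})) = card (arc_systems 0 n)"
proof -
  have "VHC_set (Av n {[2, 3, 1], [3, 2, 1]}) = (\<lambda>(c, H). (block_perm 0 c, H)) ` arc_systems 0 n"
    unfolding VHC_set_def VHC_def Av_231_321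
    by (auto simp: arc_systems_def compositions_def image_iff valid_hook_configuration_block_perm)
  moreover have "inj_on (\<lambda>(c, H). (block_perm 0 c, H)) (arc_systems 0 n)"
    by (auto intro!: inj_onI dest: block_perm_inject simp: arc_systems_def compositions_def)
  ultimately show ?thesis
    by (simp add: card_image)
qed

section \<open>Cutting an arc system at a block start\<close>

lemma block_starts_append: "block_starts s (c @ d) = block_starts s c @ block_starts (s + sum_list c) d"
  by (induction c arbitrary: s) (auto simp: add.assoc)

lemma block_descents_append:
  "block_descents s (c @ d) = block_descents s c @ block_descents (s + sum_list c) d"
  by (induction c arbitrary: s) (auto simp: add.assoc)

lemma block_starts_splitE:
  assumes "i \<in> set (block_starts s c)"
  obtains u v where "c = u @ v" "v \<noteq> []" "i = s + sum_list u"
  using assms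
proof (induction c arbitrary: s thesis)
  case (Cons k c)
  show ?case
  proof (cases "i = s")
    case True
    then show ?thesis by (intro Cons.prems(1)[of "[]"]) auto
  next
    case False
    then obtain u v where "c = u @ v" "v \<noteq> []" "i = s + k + sum_list u"
      using Cons.prems(2) by (auto elim: Cons.IH[of "s + k", rotated])
    then show ?thesis by (intro Cons.prems(1)[of "k # u"]) auto
  qed
qed simp

text \<open>Partial sums of positive parts increase strictly, so a prefix is determined by its
  sum.\<close>

lemma prefix_eq_if_sum_list_eq:
  "0 \<notin> set (u @ v) \<Longrightarrow> u @ v = u' @ v' \<Longrightarrow> sum_list u = sum_list u' \<Longrightarrow> u = (u' :: nat list)"
proof (induction u arbitrary: u')
  case Nil
  then show ?case by (cases u') auto
next
  case (Cons a u)
  have "u' \<noteq> []"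
    using Cons.prems(1,3) by auto
  with Cons.prems(2) obtain w where w: "u' = a # w" "u @ v = w @ v'"
    by (auto simp: Cons_eq_append_conv)
  moreover have "u = w"
    using Cons.prems(1,3) by (intro Cons.IH[OF _ w(2)]) (auto simp: w(1))
  ultimately show ?case
    by simp
qed

text \<open>A block of size 1 starts no arc, and none ends there: all arcs start later and run to
  the right.\<close>

lemma arc_system_Cons_1:
  assumes "0 \<notin> set c"
  shows "arc_system s (1 # c) H \<longleftrightarrow> arc_system (Suc s) c H"
proof
  assume *: "arc_system s (1 # c) H"
  have "snd h \<in> set (block_starts (Suc s) c)" if h: "h \<in> set H" for h
  proof -
    have "fst h \<in> set (map fst H)"
      using h by simp
    then have "fst h \<in> set (block_starts (Suc s) c)"
      using * block_descents_subset[of "Suc s" c] unfolding arc_system_def by force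
    then show ?thesis
      using * h block_starts_bounds[OF assms, of "fst h" "Suc s"] by (auto simp: arc_system_def)
  qed
  then show "arc_system (Suc s) c H"
    using * by (simp add: arc_system_def)
qed (auto simp: arc_system_def)

text \<open>The first arc separates the others: those starting under it must end strictly before its
  right end, the rest start at or after that end. The condition on \<open>length H1\<close> puts the
  cut of the arc list at the same place, and \<open>v \<noteq> []\<close> makes the right end a
  block start.\<close>

lemma arc_system_Cons_append:
  assumes "0 \<notin> set (u @ v)" "v \<noteq> []" "2 \<le> k" "length H1 = length (block_descents (s + k) u)"
  shows "arc_system s (k # u @ v) ((s, s + k + sum_list u) # H1 @ H2) \<longleftrightarrow>
    arc_system (s + k) u H1 \<and> arc_system (s + k + sum_list u) v H2" (is "?L \<longleftrightarrow> ?R")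
proof -
  define t where "t = s + k + sum_list u"
  have t: "t \<in> set (block_starts t v)"
    using assms(2) by (cases v) auto
  have pos: "0 \<notin> set u" "0 \<notin> set v"
    using assms(1) by auto
  note u_bounds = block_starts_bounds[OF pos(1), of _ "s + k", folded t_def]
  note v_bounds = block_starts_bounds[OF pos(2), of _ t]
  show ?thesis
    unfolding t_def[symmetric]
  proof (intro iffI conjI)
    assume "arc_system s (k # u @ v) ((s, t) # H1 @ H2)"
    then have L: "map fst H1 = block_descents (s + k) u" "map fst H2 = block_descents t v"
      "\<And>h. h \<in> set H1 \<union> set H2 \<Longrightarrow> fst h < snd h"
      "\<And>h. h \<in> set H1 \<union> set H2 \<Longrightarrow>
        snd h \<in> insert s (set (block_starts (s + k) u) \<union> set (block_starts t v))"
      "noncrossing H1" "noncrossing H2" "\<And>h. h \<in> set H1 \<Longrightarrow> fst h < t \<Longrightarrow> snd h < t"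
      using assms(3,4)
      by (auto simp: arc_system_def noncrossing_def block_starts_append block_descents_append
          sorted_wrt_append t_def add.assoc)
    have 1: "fst h \<in> set (block_starts (s + k) u)" if "h \<in> set H1" for h
      using that L(1) block_descents_subset[of "s + k" u] by (metis imageI list.set_map subsetD)
    have 2: "fst h \<in> set (block_starts t v)" if "h \<in> set H2" for h
      using that L(2) block_descents_subset[of t v] by (metis imageI list.set_map subsetD)
    \<comment> \<open>The right end is after \<open>s\<close> by \<open>fst h < snd h\<close>, and
      before \<open>t\<close> by noncrossing with the first arc, so it is a block start of
      \<open>u\<close>.\<close>
    have "snd h \<in> set (block_starts (s + k) u)" if "h \<in> set H1" for h
      using that L(3,4,7)[of h] u_bounds[OF 1[OF that]] v_bounds[of "snd h"] by fastforce
    then show "arc_system (s + k) u H1"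
      using L by (simp add: arc_system_def)
    have "snd h \<in> set (block_starts t v)" if "h \<in> set H2" for h
      using that L(3,4)[of h] v_bounds[OF 2[OF that]] u_bounds[of "snd h"] by (fastforce simp: t_def)
    then show "arc_system t v H2"
      using L by (simp add: arc_system_def)
  next
    assume R: "arc_system (s + k) u H1 \<and> arc_system t v H2"
    have 2: "t \<le> fst h" if "h \<in> set H2" for h
      using that R block_descents_subset[of t v] v_bounds unfolding arc_system_def
      by (metis imageI list.set_map subsetD)
    have 1: "snd h < t" if "h \<in> set H1" for h
      using that R u_bounds unfolding arc_system_def by blast
    \<comment> \<open>Arcs of \<open>H1\<close> end before \<open>t\<close> and arcs of
      \<open>H2\<close> start at \<open>t\<close> or later, so no new pair can cross.\<close>
    have "noncrossing ((s, t) # H1 @ H2)"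
      using R 1 2 by (fastforce simp: noncrossing_def arc_system_def sorted_wrt_append)
    moreover have "s < t"
      using assms(3) by (simp add: t_def)
    ultimately show "arc_system s (k # u @ v) ((s, t) # H1 @ H2)"
      using R t assms(3)
      by (auto simp: arc_system_def block_starts_append block_descents_append t_def add.assoc)
  qed
qed

section \<open>Decomposition by the first block\<close>

lemma arc_systems_0: "arc_systems s 0 = {([], [])}"
proof -
  have "compositions 0 = {[]}"
    by (auto simp: compositions_def) (metis list.set_intros(1) neq_Nil_conv)
  moreover have "arc_system s [] H \<longleftrightarrow> H = []" for H
    by (auto simp: arc_system_def noncrossing_def)
  ultimately show ?thesis
    by (auto simp: arc_systems_def)
qed

definition join_arc_systems ::
  "nat \<Rightarrow> nat \<times> nat \<times> (nat list \<times> hook list) \<times> (nat list \<times> hook list) \<Rightarrow> nat list \<times> hook list" where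
  "join_arc_systems s = (\<lambda>(k, i, (u, H1), (v, H2)). (k # u @ v, (s, s + k + i) # H1 @ H2))"

text \<open>Here \<open>k\<close> is the size of the first block and \<open>i\<close> the total size
  of the blocks under its arc. The strict bound \<open>i < n - k\<close> leaves a nonempty
  remainder, in whose first block the arc ends; it becomes the factor \<open>F - 1\<close> of the
  functional equation.\<close>

definition splittings ::
  "nat \<Rightarrow> nat \<Rightarrow> (nat \<times> nat \<times> (nat list \<times> hook list) \<times> (nat list \<times> hook list)) set" where
  "splittings s n = (SIGMA k:{2..n}. SIGMA i:{..<n - k}.
     arc_systems (s + k) i \<times> arc_systems (s + k + i) (n - k - i))"

text \<open>The first part gives \<open>k\<close> and the end of the first arc gives
  \<open>i\<close>. Then \<open>i\<close> as a partial sum separates \<open>u\<close> from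
  \<open>v\<close>, and the number of descents of \<open>u\<close> separates \<open>H1\<close> from
  \<open>H2\<close>.\<close>

lemma inj_on_join_arc_systems: "inj_on (join_arc_systems s) (splittings s n)"
proof (rule inj_onI)
  fix p p'
  assume p: "p \<in> splittings s n" and p': "p' \<in> splittings s n"
    and eq: "join_arc_systems s p = join_arc_systems s p'"
  obtain k i u H1 v H2 where pd: "p = (k, i, (u, H1), (v, H2))"
    by (metis prod.exhaust)
  obtain k' i' u' H1' v' H2' where pd': "p' = (k', i', (u', H1'), (v', H2'))"
    by (metis prod.exhaust)
  have *: "k = k'" "i = i'" "u @ v = u' @ v'" "H1 @ H2 = H1' @ H2'"
    using eq by (auto simp: pd pd' join_arc_systems_def)
  have **: "sum_list u = i" "sum_list u' = i'" "0 \<notin> set (u @ v)"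
    "map fst H1 = block_descents (s + k) u" "map fst H1' = block_descents (s + k') u'"
    using p p' by (auto simp: pd pd' splittings_def arc_systems_def compositions_def arc_system_def)
  have "u = u'"
    using prefix_eq_if_sum_list_eq[OF **(3) *(3)] * ** by simp
  moreover from this have "length H1 = length H1'"
    using * ** by (metis length_map)
  ultimately show "p = p'"
    using * by (simp add: pd pd')
qed

text \<open>Either the first block has size 1 and carries no arc, or it carries one, whose end cuts
  the remaining blocks in two.\<close>

lemma arc_systems_rec:
  assumes "0 < n"
  shows "arc_systems s n =
    (\<lambda>(c, H). (1 # c, H)) ` arc_systems (Suc s) (n - 1) \<union> join_arc_systems s ` splittings s n"
proof (intro equalityI subsetI)
  fix p
  assume "p \<in> arc_systems s n"
  then obtain c H where p: "p = (c, H)" "0 \<notin> set c" "sum_list c = n" "arc_system s c H"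
    by (auto simp: arc_systems_def compositions_def)
  then obtain k d where c: "c = k # d"
    using assms by (cases c) auto
  show "p \<in> (\<lambda>(c, H). (1 # c, H)) ` arc_systems (Suc s) (n - 1) \<union>
      join_arc_systems s ` splittings s n"
  proof (cases "k = 1")
    case True
    then have "(d, H) \<in> arc_systems (Suc s) (n - 1)"
      using p arc_system_Cons_1[of d s H] by (auto simp: c arc_systems_def compositions_def)
    then show ?thesis
      using True p by (intro UnI1 image_eqI[of _ _ "(d, H)"]) (auto simp: c)
  next
    case False
    then have k: "2 \<le> k"
      using p(2) by (auto simp: c)
    then obtain t H' where H: "H = (s, t) # H'" "map fst H' = block_descents (s + k) d"
      using p(4) by (cases H) (auto simp: c arc_system_def)
    have "t \<in> set (block_starts (s + k) d)"
      using p(4) by (auto simp: c H arc_system_def)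
    then obtain u v where uv: "d = u @ v" "v \<noteq> []" "t = s + k + sum_list u"
      by (elim block_starts_splitE)
    \<comment> \<open>The arcs are listed by left endpoint, so those from blocks of \<open>u\<close>
      come first, one for each descent.\<close>
    define H1 H2 where "H1 = take (length (block_descents (s + k) u)) H'"
      and "H2 = drop (length (block_descents (s + k) u)) H'"
    have "length H' = length (block_descents (s + k) d)"
      using H(2) by (metis length_map)
    then have len: "length H1 = length (block_descents (s + k) u)" and H': "H' = H1 @ H2"
      by (auto simp: H1_def H2_def uv(1) block_descents_append)
    have "arc_system (s + k) u H1 \<and> arc_system (s + k + sum_list u) v H2"
      using p(2,4) arc_system_Cons_append[OF _ uv(2) k len, of H2] by (auto simp: c H uv H')
    moreover have "0 < sum_list v"
      using p(2) uv(2) by (cases v) (auto simp: c uv(1))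
    ultimately have "(k, sum_list u, (u, H1), (v, H2)) \<in> splittings s n"
      using p(2,3) k by (auto simp: c uv(1) splittings_def arc_systems_def compositions_def)
    then show ?thesis
      unfolding p(1) c H(1) H' uv(1,3)
      by (intro UnI2 image_eqI[rotated]) (auto simp: join_arc_systems_def)
  qed
next
  fix p
  assume "p \<in> (\<lambda>(c, H). (1 # c, H)) ` arc_systems (Suc s) (n - 1) \<union>
    join_arc_systems s ` splittings s n"
  then show "p \<in> arc_systems s n"
  proof
    assume "p \<in> (\<lambda>(c, H). (1 # c, H)) ` arc_systems (Suc s) (n - 1)"
    then show ?thesis
      using assms arc_system_Cons_1 by (auto simp: arc_systems_def compositions_def)
  next
    assume "p \<in> join_arc_systems s ` splittings s n"
    then obtain k i u H1 v H2 where p: "p = (k # u @ v, (s, s + k + sum_list u) # H1 @ H2)"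
      and k: "2 \<le> k" "k \<le> n" and i: "sum_list u < n - k" "sum_list v = n - k - sum_list u"
      and pos: "0 \<notin> set (u @ v)"
      and sys: "arc_system (s + k) u H1" "arc_system (s + k + sum_list u) v H2"
      by (auto simp: join_arc_systems_def splittings_def arc_systems_def compositions_def)
    have "length H1 = length (block_descents (s + k) u)"
      using sys(1) unfolding arc_system_def by (metis length_map)
    moreover have "v \<noteq> []"
      using i by auto
    ultimately have "arc_system s (k # u @ v) ((s, s + k + sum_list u) # H1 @ H2)"
      using arc_system_Cons_append[OF pos _ k(1)] sys by blast
    then show ?thesis
      using k i pos by (auto simp: p arc_systems_def compositions_def)
  qed
qed

section \<open>Cardinalities\<close>

lemma finite_splittings:
  assumes "\<And>m s. m < n \<Longrightarrow> finite (arc_systems s m)"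
  shows "finite (splittings s n)"
  unfolding splittings_def by (intro finite_SigmaI finite_cartesian_product assms) auto

lemma finite_arc_systems: "finite (arc_systems s n)"
proof (induction n arbitrary: s rule: less_induct)
  case (less n)
  then show ?case
    by (cases "n = 0") (auto simp: arc_systems_0 arc_systems_rec intro!: finite_splittings)
qed

lemma card_arc_systems_rec:
  assumes "0 < n"
  shows "card (arc_systems s n) = card (arc_systems (Suc s) (n - 1)) +
    (\<Sum>k=2..n. \<Sum>i<n - k. card (arc_systems (s + k) i) * card (arc_systems (s + k + i) (n - k - i)))"
proof -
  have "inj_on (\<lambda>(c, H). (1 # c, H)) (arc_systems (Suc s) (n - 1))"
    by (auto intro!: inj_onI)
  moreover have "card (splittings s n) = (\<Sum>k=2..n. \<Sum>i<n - k.
      card (arc_systems (s + k) i) * card (arc_systems (s + k + i) (n - k - i)))"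
    unfolding splittings_def by (simp add: finite_arc_systems card_cartesian_product)
  \<comment> \<open>The first part is 1 in one set and at least 2 in the other.\<close>
  moreover have "(\<lambda>(c, H). (1 # c, H)) ` arc_systems (Suc s) (n - 1) \<inter>
      join_arc_systems s ` splittings s n = {}"
    by (auto simp: join_arc_systems_def splittings_def)
  ultimately show ?thesis
    unfolding arc_systems_rec[OF assms]
    by (subst card_Un_disjoint)
      (simp_all add: finite_arc_systems finite_splittings card_image inj_on_join_arc_systems
        del: One_nat_def)
qed

text \<open>The recursion involves \<open>s\<close> only through the offsets of smaller systems,
  where the induction hypothesis replaces every offset by 0.\<close>

lemma card_arc_systems_shift: "card (arc_systems s n) = card (arc_systems 0 n)"
proof (induction n arbitrary: s rule: less_induct)
  case (less n)
  show ?case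
  proof (cases "n = 0")
    case False
    have eq: "card (arc_systems s n) = card (arc_systems 0 (n - 1)) +
      (\<Sum>k=2..n. \<Sum>i<n - k. card (arc_systems 0 i) * card (arc_systems 0 (n - k - i)))" for s
      unfolding card_arc_systems_rec[of n s, OF False[unfolded neq0_conv]]
      by (intro arg_cong2[of _ _ _ _ "(+)"] sum.cong arg_cong2[of _ _ _ _ "(*)"] less refl)
        (use False in auto)
    show ?thesis
      by (rule trans[OF eq eq[symmetric]])
  qed (simp add: arc_systems_0)
qed

lemma card_arc_systems_0_rec:
  assumes "0 < n"
  shows "card (arc_systems 0 n) = card (arc_systems 0 (n - 1)) +
    (\<Sum>k=2..n. \<Sum>i<n - k. card (arc_systems 0 i) * card (arc_systems 0 (n - k - i)))"
  unfolding card_arc_systems_rec[OF assms, of 0]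
  by (intro arg_cong2[of _ _ _ _ "(+)"] sum.cong arg_cong2[of _ _ _ _ "(*)"] card_arc_systems_shift refl)

section \<open>The generating function\<close>

text \<open>The recursion reads \<open>F = 1 + fps_X * F + y * (F * (F - 1))\<close>; multiplying by
  \<open>1 - fps_X\<close> clears the denominator of \<open>y\<close>.\<close>

lemma generating_function_equation:
  fixes F :: "real fps"
  defines "F \<equiv> Abs_fps (\<lambda>n. real (card (arc_systems 0 n)))"
  shows "(1 - fps_X) * (F - 1 - fps_X * F) = fps_X ^ 2 * F * (F - 1)"
proof -
  define y :: "real fps" where "y = Abs_fps (\<lambda>k. if 2 \<le> k then 1 else 0)"
  have y: "(1 - fps_X) * y = fps_X ^ 2"
    by (rule fps_ext) (auto simp: y_def algebra_simps fps_X_power_iff)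
  have "F = 1 + fps_X * F + y * (F * (F - 1))"
  proof (rule fps_ext)
    fix n
    show "fps_nth F n = fps_nth (1 + fps_X * F + y * (F * (F - 1))) n"
    proof (cases "n = 0")
      case True
      then show ?thesis
        by (simp add: F_def y_def arc_systems_0)
    next
      case False
      \<comment> \<open>The constant coefficient of \<open>F\<close> is 1, so that of
        \<open>F - 1\<close> vanishes and the term \<open>i = m\<close> drops out.\<close>
      have inner: "fps_nth (F * (F - 1)) m = (\<Sum>i<m. fps_nth F i * fps_nth F (m - i))" for m
      proof -
        have "fps_nth (F * (F - 1)) m = (\<Sum>i\<in>{0..m}. fps_nth F i * fps_nth (F - 1) (m - i))"
          by (simp only: fps_mult_nth)
        also have "\<dots> = (\<Sum>i<m. fps_nth F i * fps_nth (F - 1) (m - i))"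
          by (intro sum.mono_neutral_right) (auto simp: F_def arc_systems_0)
        also have "\<dots> = (\<Sum>i<m. fps_nth F i * fps_nth F (m - i))"
          by (intro sum.cong) auto
        finally show ?thesis .
      qed
      have "fps_nth (y * (F * (F - 1))) n = (\<Sum>k\<in>{0..n}. fps_nth y k * fps_nth (F * (F - 1)) (n - k))"
        by (simp only: fps_mult_nth)
      also have "\<dots> = (\<Sum>k=2..n. fps_nth y k * fps_nth (F * (F - 1)) (n - k))"
        by (intro sum.mono_neutral_right) (auto simp: y_def)
      also have "\<dots> = (\<Sum>k=2..n. \<Sum>i<n - k. fps_nth F i * fps_nth F (n - k - i))"
        by (intro sum.cong) (auto simp: y_def inner)
      finally have "fps_nth (y * (F * (F - 1))) n =
        (\<Sum>k=2..n. \<Sum>i<n - k. fps_nth F i * fps_nth F (n - k - i))" .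
      moreover have "fps_nth F n = fps_nth F (n - 1) +
        (\<Sum>k=2..n. \<Sum>i<n - k. fps_nth F i * fps_nth F (n - k - i))"
        using False card_arc_systems_0_rec[of n] by (simp add: F_def)
      ultimately show ?thesis
        using False by simp
    qed
  qed
  with y show ?thesis
    by algebra
qed

theorem theorem5:
  "Abs_fps (\<lambda>n. real (card (VHC_set (Av n {[2, 3, 1], [3, 2, 1]})))) =
     (1 - 2 * fps_X + 2 * fps_X ^ 2
        - fps_sqrt (1 - 4 * fps_X + 4 * fps_X ^ 2 - 4 * fps_X ^ 3 + 4 * fps_X ^ 4))
     / (2 * fps_X ^ 2)"
proof -
  define F :: "real fps" where "F = Abs_fps (\<lambda>n. real (card (arc_systems 0 n)))"
  define D :: "real fps" where "D = 1 - 4 * fps_X + 4 * fps_X ^ 2 - 4 * fps_X ^ 3 + 4 * fps_X ^ 4"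
  \<comment> \<open>The functional equation is the quadratic
    \<open>x^2 F^2 - (1 - 2 x + 2 x^2) F + (1 - x) = 0\<close> with discriminant \<open>D\<close>;
    completing the square gives \<open>A ^ 2 = D\<close>.\<close>
  define A where "A = 1 - 2 * fps_X + 2 * fps_X ^ 2 - 2 * fps_X ^ 2 * F"
  have "(1 - fps_X) * (F - 1 - fps_X * F) = fps_X ^ 2 * F * (F - 1)"
    unfolding F_def by (rule generating_function_equation)
  then have "A ^ 2 = D"
    unfolding A_def D_def by algebra
  \<comment> \<open>Of the two square roots of \<open>D\<close>, the constant coefficient 1 singles
    out \<open>A\<close> as the one meant by \<open>fps_sqrt\<close>.\<close>
  moreover have "fps_nth A 0 = 1" "fps_nth D 0 = 1"
    by (simp_all add: A_def D_def)
  ultimately have sqrt: "fps_sqrt D = A"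
    using radical_unique[of root 1 D A] by (simp add: numeral_2_eq_2)
  have "1 - 2 * fps_X + 2 * fps_X ^ 2 - fps_sqrt D = 2 * fps_X ^ 2 * F"
    unfolding sqrt A_def by simp
  moreover have "2 * fps_X ^ 2 \<noteq> (0 :: real fps)"
    by simp
  ultimately show ?thesis
    unfolding D_def[symmetric] card_VHC_set F_def[symmetric]
    by (simp only: nonzero_mult_div_cancel_left not_False_eq_True)
qed

end
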